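(* Let $h\in C^2(\mathbb T,\mathbb R^3)$ be fixed. There are constants $a_h,c_h,C_h'>0$ with the following property. If $\gamma:\mathbb T\to\mathbb R^3$ is a unit-speed embedded $C^{1,1}$-curve of length one and thickness $\Delta:=\operatorname{Thi}(\gamma)>0$, and if $\varepsilon\in\mathbb R$ satisfies $|\varepsilon|\le a_h\Delta$, then for every $r\in[-1,1]$ the curve $\eta_r:=\gamma+r\varepsilon h$ is a regular embedded $C^{1,1}$-curve ambient isotopic to $\gamma$, and $$\operatorname{Thi}(\eta_r)\ge c_h\Delta,\qquad \operatorname{Rop}(\eta_r)\le\frac{C_h'}{\Delta}.$$ The constants are independent of $\gamma$ and $\Delta$.
   Context: $\mathbb T=\mathbb R/\mathbb Z$. For a regular $C^1$-curve $\gamma:\mathbb T\to\mathbb R^3$ with unit tangent $T_\gamma=\gamma'/|\gamma'|$ and $s\neq t$, let $r_{\mathrm{tp}}[\gamma](s,t)=\dfrac{|\gamma(t)-\gamma(s)|^2}{2|P^\perp_{T_\gamma(s)}(\gamma(t)-\gamma(s))|}$, where $P^\perp_{T}=I-T\otimes T$, with value $0$ if $\gamma(t)=\gamma(s)$ and $+\infty$ if the chord is nonzero but the denominator vanishes. The thickness is $\operatorname{Thi}(\gamma)=\inf_{s\ne t}r_{\mathrm{tp}}[\gamma](s,t)$. Ropelength is $\operatorname{Rop}(\gamma)=\mathscr L(\gamma)/\operatorname{Thi}(\gamma)$, where $\mathscr L(\gamma)=\int_{\mathbb T}|\gamma'|\,dt$, with $\operatorname{Rop}(\gamma)=+\infty$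 if $\operatorname{Thi}(\gamma)=0$. *)

theory Defs
  imports "HOL-Analysis.Analysis" "HOL-Library.Periodic_Fun"
begin

text \<open>
  Maps on the circle \<open>\<real>/\<int>\<close> are represented by their lifts, i.e. by functions on
  \<open>real\<close> of period \<open>1\<close>. Accordingly, two parameters \<open>s\<close>, \<open>t\<close> are distinct points of
  the circle iff \<open>s - t \<notin> \<int>\<close>, and \<open>{0..<1}\<close> is a fundamental domain.
\<close>

type_synonym curve = "real \<Rightarrow> real^3"

definition velocity :: "curve \<Rightarrow> curve" where
  "velocity \<gamma> t = vector_derivative \<gamma> (at t)"

definition C1_closed :: "curve \<Rightarrow> bool" where
  "C1_closed \<gamma> \<longleftrightarrow> periodic_fun_simple' \<gamma> \<and> \<gamma> C1_differentiable_on UNIV"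

definition C2_closed :: "curve \<Rightarrow> bool" where
  "C2_closed \<gamma> \<longleftrightarrow> C1_closed \<gamma> \<and> velocity \<gamma> C1_differentiable_on UNIV"

definition C11_closed :: "curve \<Rightarrow> bool" where
  "C11_closed \<gamma> \<longleftrightarrow> C1_closed \<gamma> \<and> (\<exists>L. L-lipschitz_on UNIV (velocity \<gamma>))"

definition regular_curve :: "curve \<Rightarrow> bool" where
  "regular_curve \<gamma> \<longleftrightarrow> (\<forall>t. velocity \<gamma> t \<noteq> 0)"

definition unit_speed :: "curve \<Rightarrow> bool" where
  "unit_speed \<gamma> \<longleftrightarrow> (\<forall>t. norm (velocity \<gamma> t) = 1)"

text \<open>
  For a regular closed \<open>C\<^sup>1\<close>-curve, being embedded amounts to injectivity on the circle,
  since the circle is compact.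
\<close>

definition embedded_curve :: "curve \<Rightarrow> bool" where
  "embedded_curve \<gamma> \<longleftrightarrow> inj_on \<gamma> {0..<1}"

definition curve_length :: "curve \<Rightarrow> real" where
  "curve_length \<gamma> = integral {0..1} (\<lambda>t. norm (velocity \<gamma> t))"

definition unit_tangent :: "curve \<Rightarrow> curve" where
  "unit_tangent \<gamma> t = velocity \<gamma> t /\<^sub>R norm (velocity \<gamma> t)"

definition perp_proj :: "real^3 \<Rightarrow> real^3 \<Rightarrow> real^3" where
  "perp_proj T v = v - (T \<bullet> v) *\<^sub>R T"

definition r_tp :: "curve \<Rightarrow> real \<Rightarrow> real \<Rightarrow> ereal" where
  "r_tp \<gamma> s t =
    (if \<gamma> t = \<gamma> s then 0
     else if perp_proj (unit_tangent \<gamma> s) (\<gamma> t - \<gamma> s) = 0 then \<infinity>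
     else ereal ((norm (\<gamma> t - \<gamma> s))\<^sup>2 /
                 (2 * norm (perp_proj (unit_tangent \<gamma> s) (\<gamma> t - \<gamma> s)))))"

definition thickness :: "curve \<Rightarrow> ereal" where
  "thickness \<gamma> = (INF (s, t) \<in> {(s, t). s - t \<notin> \<int>}. r_tp \<gamma> s t)"

definition ropelength :: "curve \<Rightarrow> ereal" where
  "ropelength \<gamma> =
    (if thickness \<gamma> = 0 then \<infinity> else ereal (curve_length \<gamma>) / thickness \<gamma>)"

text \<open>
  An ambient isotopy is a homotopy through self-homeomorphisms of \<open>\<real>\<^sup>3\<close> starting at the
  identity; it is required to carry one parametrised curve to the other.
\<close>

definition ambient_isotopic :: "curve \<Rightarrow> curve \<Rightarrow> bool" where
  "ambient_isotopic \<gamma> \<eta> \<longleftrightarrow>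
    (\<exists>\<Phi>. homotopic_with_canon (\<lambda>f. \<exists>g. homeomorphism UNIV UNIV f g) UNIV UNIV id \<Phi> \<and>
         \<Phi> \<circ> \<gamma> = \<eta>)"

end

theory Submission
  imports Defs
begin

text \<open>
  Every argument rests on the inequality \<open>2 D |P\<^sup>\<bottom>(\<gamma> t - \<gamma> s)| \<le> |\<gamma> t - \<gamma> s|\<^sup>2\<close>, where \<open>D\<close> is the
  thickness. Applied at both ends of a short chord it makes the tangent \<open>1/D\<close>-Lipschitz, and applied
  at a point of minimal distance it keeps the remaining chords above \<open>D/4\<close>. Hence
  \<open>|\<gamma> t - \<gamma> s| \<ge> min (|t - s|/2) (D/4)\<close>, so that \<open>h \<circ> \<gamma>\<^sup>-\<^sup>1\<close> is Lipschitz with a constant of order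
  \<open>1/D\<close>. A perturbation \<open>\<mu> h\<close> with \<open>\<bar>\<mu>\<bar> \<le> a D\<close> therefore shortens no chord by more than a fixed
  factor, which bounds the new thickness from below; and \<open>\<mu> h \<circ> \<gamma>\<^sup>-\<^sup>1\<close> extends to a contraction \<open>V\<close>
  of space, so that \<open>id + \<theta> V\<close>, \<open>0 \<le> \<theta> \<le> 1\<close>, is an ambient isotopy.
\<close>

section \<open>Lipschitz maps\<close>

text \<open>McShane's extension: \<open>g\<close> is the lower envelope of the cones of slope
  \<open>L\<close> with apex on the graph of \<open>f\<close>.\<close>

lemma lipschitz_extension_real:
  fixes f :: "'a::metric_space \<Rightarrow> real"
  assumes f: "L-lipschitz_on S f"
  obtains g where "L-lipschitz_on UNIV g" "\<And>x. x \<in> S \<Longrightarrow> g x = f x"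
proof (cases "S = {}")
  case True
  \<comment> \<open>The envelope needs at least one cone, so the empty set gets a constant
    function.\<close>
  have "L-lipschitz_on UNIV (\<lambda>x::'a. 0::real)"
    using f lipschitz_on_nonneg by (auto simp: lipschitz_on_def)
  with True show ?thesis by (auto intro: that)
next
  case False
  have L: "0 \<le> L" using f by (rule lipschitz_on_nonneg)
  define g where "g x = (INF y\<in>S. f y + L * dist x y)" for x
  \<comment> \<open>Every inverted cone lies below every upright one. This bounds the infimum from
    below and keeps \<open>g\<close> from dropping under \<open>f\<close> on
    \<open>S\<close>.\<close>
  have lower: "f y' - L * dist x y' \<le> f y + L * dist x y" if "y \<in> S" "y' \<in> S" for x y y'
  proof -
    have "\<bar>f y' - f y\<bar> \<le> L * dist y' y"
      using lipschitz_onD[OF f that(2,1)] by (simp add: dist_real_def)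
    also have "\<dots> \<le> L * (dist x y' + dist x y)"
      by (intro mult_left_mono L dist_triangle3)
    finally show ?thesis by (simp add: algebra_simps)
  qed
  have bdd: "bdd_below ((\<lambda>y. f y + L * dist x y) ` S)" for x
    using False lower by (metis (no_types, lifting) bdd_belowI2 ex_in_conv)
  have le: "g x \<le> g x' + L * dist x x'" for x x'
  proof -
    have "g x - L * dist x x' \<le> g x'"
      unfolding g_def[of x']
    proof (rule cINF_greatest[OF False])
      fix y assume y: "y \<in> S"
      have "g x \<le> f y + L * dist x y"
        unfolding g_def by (rule cINF_lower[OF bdd y])
      also have "L * dist x y \<le> L * (dist x x' + dist x' y)"
        by (intro mult_left_mono L dist_triangle)
      finally show "g x - L * dist x x' \<le> f y + L * dist x' y"
        by (simp add: algebra_simps)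
    qed
    then show ?thesis by simp
  qed
  have "L-lipschitz_on UNIV g"
  proof (rule lipschitz_onI[OF _ L])
    fix x y
    show "dist (g x) (g y) \<le> L * dist x y"
      using le[of x y] le[of y x] by (simp add: dist_real_def dist_commute abs_le_iff)
  qed
  moreover have "g x = f x" if x: "x \<in> S" for x
  proof (rule antisym)
    show "g x \<le> f x"
      using cINF_lower[OF bdd x, of x] by (simp add: g_def)
    show "f x \<le> g x"
      unfolding g_def using lower[OF _ x, of _ x] by (intro cINF_greatest[OF False]) simp
  qed
  ultimately show ?thesis by (rule that)
qed

text \<open>McShane in each coordinate, with the norm bounded by the sum of the coordinates. The
  lost factor is affordable: in dimension 3 the constant 1/8 becomes 3/8, still a
  contraction.\<close>

lemma lipschitz_extension_vec:
  fixes f :: "'a::metric_space \<Rightarrow> real^'n"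
  assumes f: "L-lipschitz_on S f"
  obtains g where "(real CARD('n) * L)-lipschitz_on UNIV g" "\<And>x. x \<in> S \<Longrightarrow> g x = f x"
proof -
  have L: "0 \<le> L" using f by (rule lipschitz_on_nonneg)
  have "L-lipschitz_on S (\<lambda>x. f x $ i)" for i
  proof (rule lipschitz_onI[OF _ L])
    fix x y assume "x \<in> S" "y \<in> S"
    then show "dist (f x $ i) (f y $ i) \<le> L * dist x y"
      using lipschitz_onD[OF f] dist_vec_nth_le[of "f x" i "f y"] by (meson order_trans)
  qed
  then have "\<exists>g. L-lipschitz_on UNIV g \<and> (\<forall>x\<in>S. g x = f x $ i)" for i
    by (rule lipschitz_extension_real[of L S "\<lambda>x. f x $ i"]) blast
  then have "\<exists>G. \<forall>i. L-lipschitz_on UNIV (G i) \<and> (\<forall>x\<in>S. G i x = f x $ i)"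
    by (intro choice allI)
  then obtain G where G: "\<And>i. L-lipschitz_on UNIV (G i)" "\<And>i x. x \<in> S \<Longrightarrow> G i x = f x $ i"
    by blast
  show ?thesis
  proof
    show "(real CARD('n) * L)-lipschitz_on UNIV (\<lambda>x. \<chi> i. G i x)"
    proof (rule lipschitz_onI)
      fix x y
      have "dist (\<chi> i. G i x) (\<chi> i. G i y) \<le> (\<Sum>i\<in>UNIV. \<bar>G i x - G i y\<bar>)"
        using norm_le_l1_cart[of "(\<chi> i. G i x) - (\<chi> i. G i y)"] by (simp add: dist_norm)
      also have "\<dots> \<le> (\<Sum>i\<in>(UNIV::'n set). L * dist x y)"
        using lipschitz_onD[OF G(1)] by (intro sum_mono) (simp add: dist_real_def)
      finally show "dist (\<chi> i. G i x) (\<chi> i. G i y) \<le> real CARD('n) * L * dist x y"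
        by simp
    qed (use L in simp)
    show "(\<chi> i. G i x) = f x" if "x \<in> S" for x
      using G(2)[OF that] by (simp add: vec_eq_iff)
  qed
qed

text \<open>Solving \<open>x + W x = y\<close> means finding the fixed point of the contraction
  \<open>\<lambda>x. y - W x\<close>. The inverse is continuous because the map shrinks no distance
  by more than the factor \<open>1 - k\<close>.\<close>

lemma homeomorphism_id_plus_contraction:
  fixes W :: "'a::banach \<Rightarrow> 'a"
  assumes W: "k-lipschitz_on UNIV W" and k: "k < 1"
  shows "\<exists>g. homeomorphism UNIV UNIV (\<lambda>x. x + W x) g"
proof -
  have k0: "0 \<le> k" using W by (rule lipschitz_on_nonneg)
  have ex: "\<exists>!x. y - W x = x" for y
    using lipschitz_onD[OF W]
    by (intro banach_fix_type[OF k0 k]) (simp add: dist_norm norm_minus_commute)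
  define g where "g y = (THE x. y - W x = x)" for y
  have g1: "g y + W (g y) = y" for y
    using theI'[OF ex[of y]] unfolding g_def by (metis diff_add_cancel)
  have g2: "g (x + W x) = x" for x
    unfolding g_def by (rule the1_equality[OF ex]) simp
  have expand: "(1 - k) * dist x y \<le> dist (x + W x) (y + W y)" for x y
  proof -
    have "dist x y = norm ((x + W x) - (y + W y) - (W x - W y))"
      by (simp add: dist_norm algebra_simps)
    also have "\<dots> \<le> dist (x + W x) (y + W y) + dist (W x) (W y)"
      by (metis dist_norm norm_triangle_ineq4)
    also have "dist (W x) (W y) \<le> k * dist x y"
      using lipschitz_onD[OF W] by simp
    finally show ?thesis by (simp add: algebra_simps)
  qed
  have "(1 / (1 - k))-lipschitz_on UNIV g"
  proof (rule lipschitz_onI)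
    show "dist (g x) (g y) \<le> 1 / (1 - k) * dist x y" for x y
      using expand[of "g x" "g y"] k by (simp add: g1 field_simps)
  qed (use k in simp)
  then have "continuous_on UNIV g" by (rule lipschitz_on_continuous_on)
  moreover have "continuous_on UNIV (\<lambda>x. x + W x)"
    using lipschitz_on_continuous_on[OF W] by (intro continuous_intros)
  ultimately show ?thesis
    using g1 g2 by (intro exI[of _ g] homeomorphismI) auto
qed

text \<open>Cut the interval into \<open>n + 1\<close> equal steps: the linear terms add up to
  \<open>A * \<bar>t - s\<bar>\<close>, while the quadratic ones total
  \<open>B * (t - s)\<^sup>2 / (n + 1)\<close> and vanish in the limit.\<close>

lemma lipschitz_on_if_quadratic_error:
  fixes f :: "real \<Rightarrow> 'a::real_normed_vector"
  assumes f: "\<And>s t. norm (f t - f s) \<le> A * \<bar>t - s\<bar> + B * (t - s)\<^sup>2" and A: "0 \<le> A"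
  shows "A-lipschitz_on UNIV f"
proof (rule lipschitz_onI[OF _ A])
  fix t s :: real
  have steps: "norm (f (s + real n * d) - f s) \<le> real n * (A * \<bar>d\<bar> + B * d\<^sup>2)" for n d
  proof (induction n)
    case (Suc n)
    have "norm (f (s + real (Suc n) * d) - f s)
        \<le> norm (f (s + real (Suc n) * d) - f (s + real n * d)) + norm (f (s + real n * d) - f s)"
      by (metis diff_add_cancel norm_triangle_ineq add_diff_eq)
    also have "norm (f (s + real (Suc n) * d) - f (s + real n * d)) \<le> A * \<bar>d\<bar> + B * d\<^sup>2"
      using f[of "s + real (Suc n) * d" "s + real n * d"] by (simp add: algebra_simps)
    finally show ?case using Suc by (simp add: algebra_simps)
  qed simp
  have "norm (f t - f s) \<le> A * \<bar>t - s\<bar> + B * (t - s)\<^sup>2 * inverse (real (Suc n))" for n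
  proof -
    have "real (Suc n) * (A * \<bar>(t - s) / real (Suc n)\<bar> + B * ((t - s) / real (Suc n))\<^sup>2)
        = A * \<bar>t - s\<bar> + B * (t - s)\<^sup>2 * inverse (real (Suc n))"
      by (simp add: abs_divide power_divide power2_eq_square divide_simps)
    then show ?thesis using steps[of "Suc n" "(t - s) / real (Suc n)"] by simp
  qed
  moreover have "(\<lambda>n. A * \<bar>t - s\<bar> + B * (t - s)\<^sup>2 * inverse (real (Suc n)))
      \<longlonglongrightarrow> A * \<bar>t - s\<bar> + B * (t - s)\<^sup>2 * 0"
    by (intro tendsto_intros LIMSEQ_inverse_real_of_nat)
  ultimately have "norm (f t - f s) \<le> A * \<bar>t - s\<bar> + B * (t - s)\<^sup>2 * 0"
    using LIMSEQ_le_const by blast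
  then show "dist (f t) (f s) \<le> A * dist t s" by (simp add: dist_norm)
qed

section \<open>Closed curves\<close>

lemma C1_closed_has_vector_derivative:
  assumes "C1_closed \<gamma>"
  shows "(\<gamma> has_vector_derivative velocity \<gamma> t) (at t within S)"
proof -
  have "\<gamma> differentiable at t"
    using assms by (auto simp: C1_closed_def C1_differentiable_on_eq)
  then have "(\<gamma> has_vector_derivative velocity \<gamma> t) (at t)"
    by (simp add: velocity_def vector_derivative_works)
  then show ?thesis by (rule has_vector_derivative_at_within)
qed

lemma C1_closed_continuous_on:
  assumes "C1_closed \<gamma>"
  shows "continuous_on S \<gamma>" "continuous_on S (velocity \<gamma>)"
proof -
  show "continuous_on S \<gamma>"
    using C1_closed_has_vector_derivative[OF assms]
    by (auto intro: has_vector_derivative_continuous simp: continuous_on_eq_continuous_within)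
  have "continuous_on UNIV (velocity \<gamma>)"
    using assms by (simp add: C1_closed_def C1_differentiable_on_eq velocity_def[abs_def])
  then show "continuous_on S (velocity \<gamma>)"
    by (rule continuous_on_subset) simp
qed

lemma C1_closed_plus_1:
  assumes "C1_closed \<gamma>"
  shows "\<gamma> (t + 1) = \<gamma> t"
  using assms by (simp add: C1_closed_def periodic_fun_simple'_def)

lemma C1_closed_plus_of_int:
  assumes "C1_closed \<gamma>"
  shows "\<gamma> (t + of_int n) = \<gamma> t"
proof -
  interpret periodic_fun_simple' \<gamma> using assms by (simp add: C1_closed_def)
  show ?thesis by (rule plus_of_int)
qed

lemma velocity_plus_of_int:
  assumes "C1_closed \<gamma>"
  shows "velocity \<gamma> (t + of_int n) = velocity \<gamma> t"
proof -
  have "((\<gamma> \<circ> (\<lambda>u. u + of_int n)) has_vector_derivative 1 *\<^sub>R velocity \<gamma> (t + of_int n)) (at t)"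
    by (rule vector_diff_chain_at)
      (auto intro!: derivative_eq_intros C1_closed_has_vector_derivative assms)
  then have "(\<gamma> has_vector_derivative velocity \<gamma> (t + of_int n)) (at t)"
    using C1_closed_plus_of_int[OF assms] by (simp add: comp_def)
  then show ?thesis
    using C1_closed_has_vector_derivative[OF assms] vector_derivative_unique_at by blast
qed

section \<open>Uniform bounds from compactness of the circle\<close>

lemma periodic_continuous_bounded:
  fixes f :: "real \<Rightarrow> 'a::real_normed_vector"
  assumes per: "\<And>t. f (t + 1) = f t" and cont: "continuous_on UNIV f"
  obtains B where "\<And>t. norm (f t) \<le> B"
proof -
  interpret periodic_fun_simple' f by standard (rule per)
  have "compact (f ` {0..1})"
    using continuous_on_subset[OF cont] by (intro compact_continuous_image) auto
  then obtain B where "\<And>x. x \<in> f ` {0..1} \<Longrightarrow> norm x \<le> B"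
    using compact_imp_bounded[of "f ` {0..1}"] unfolding bounded_iff by blast
  then have B: "\<And>t. 0 \<le> t \<Longrightarrow> t \<le> 1 \<Longrightarrow> norm (f t) \<le> B"
    by simp
  have "norm (f t) \<le> B" for t
    using B[of "frac t"] minus_of_int[of t "\<lfloor>t\<rfloor>"] frac_ge_0[of t] frac_lt_1[of t]
    by (simp add: frac_def)
  then show ?thesis by (rule that)
qed

lemma lipschitz_on_of_vector_derivative_bound:
  fixes f :: "real \<Rightarrow> 'a::real_normed_vector"
  assumes f: "\<And>t. (f has_vector_derivative f' t) (at t)" and B: "\<And>t. norm (f' t) \<le> B"
  shows "B-lipschitz_on UNIV f"
proof (rule lipschitz_onI)
  show B0: "0 \<le> B"
    using B[of 0] norm_ge_zero[of "f' 0"] by linarith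
  have "onorm (\<lambda>x. x *\<^sub>R f' t) \<le> B" for t
    using B[of t] by (intro onorm_bound B0) (simp add: mult.commute[of B] mult_left_mono)
  then show "dist (f s) (f t) \<le> B * dist s t" for s t
    using f differentiable_bound[of UNIV f "\<lambda>t x. x *\<^sub>R f' t" B s t]
    by (simp add: dist_norm has_vector_derivative_def)
qed

lemma C1_closed_lipschitz:
  assumes f: "C1_closed f"
  obtains B where "B-lipschitz_on UNIV f" "\<And>t. norm (velocity f t) \<le> B"
proof -
  obtain B where B: "\<And>t. norm (velocity f t) \<le> B"
    using velocity_plus_of_int[OF f, of _ 1] C1_closed_continuous_on(2)[OF f]
    by (auto intro: periodic_continuous_bounded[of "velocity f"])
  have "B-lipschitz_on UNIV f"
    using C1_closed_has_vector_derivative[OF f] B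
    by (rule lipschitz_on_of_vector_derivative_bound)
  then show ?thesis using B by (rule that)
qed

text \<open>The velocity of \<open>h\<close> is again a closed C1 curve, so the bound for such
  curves applies twice. \<open>1 \<le> M\<close> allows division by \<open>M\<close>.\<close>

lemma C2_closed_bound:
  assumes h: "C2_closed h"
  obtains M where "1 \<le> M" "M-lipschitz_on UNIV h" "M-lipschitz_on UNIV (velocity h)"
    "\<And>t. norm (velocity h t) \<le> M"
proof -
  have closed: "C1_closed h" and closed': "C1_closed (velocity h)"
    using h velocity_plus_of_int[of h _ 1]
    by (auto simp: C2_closed_def C1_closed_def periodic_fun_simple'_def)
  obtain A where A: "A-lipschitz_on UNIV h" "\<And>t. norm (velocity h t) \<le> A"
    using C1_closed_lipschitz[OF closed] by blast
  obtain B where B: "B-lipschitz_on UNIV (velocity h)"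
    using C1_closed_lipschitz[OF closed'] by blast
  show ?thesis
    by (rule that[of "max 1 (max A B)"])
      (auto intro: lipschitz_on_mono[OF A(1)] lipschitz_on_mono[OF B] simp: le_max_iff_disj A(2))
qed

text \<open>Mean value inequality: between \<open>s\<close> and \<open>t\<close> the velocity stays
  within \<open>L * \<bar>t - s\<bar>\<close> of its value at \<open>s\<close>.\<close>

lemma norm_chord_linearization_le:
  assumes "C1_closed \<gamma>" and L: "L-lipschitz_on UNIV (velocity \<gamma>)"
  shows "norm (\<gamma> t - \<gamma> s - (t - s) *\<^sub>R velocity \<gamma> s) \<le> L * (t - s)\<^sup>2"
proof -
  have "norm (\<gamma> t - \<gamma> s - (t - s) *\<^sub>R velocity \<gamma> s) \<le> norm (t - s) * (L * \<bar>t - s\<bar>)"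
  proof (rule vector_differentiable_bound_linearization[of "closed_segment s t"])
    fix x assume "x \<in> closed_segment s t"
    then have "\<bar>x - s\<bar> \<le> \<bar>t - s\<bar>"
      by (auto simp: closed_segment_eq_real_ivl split: if_splits)
    then have "L * \<bar>x - s\<bar> \<le> L * \<bar>t - s\<bar>"
      using lipschitz_on_nonneg[OF L] by (rule mult_left_mono)
    then show "norm (velocity \<gamma> x - velocity \<gamma> s) \<le> L * \<bar>t - s\<bar>"
      using lipschitz_onD[OF L, of x s] by (simp add: dist_norm)
  qed (use C1_closed_has_vector_derivative[OF assms(1)] in auto)
  also have "\<dots> = L * (t - s)\<^sup>2"
    by (simp add: power2_eq_square mult.left_commute[of _ L])
  finally show ?thesis .
qed

text \<open>By Pythagoras the projection realises the distance from \<open>d\<close> to the line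
  spanned by \<open>T\<close>, so any convenient point of that line gives an upper bound.\<close>

lemma norm_perp_proj_le:
  assumes "norm T = 1"
  shows "norm (perp_proj T d) \<le> norm (d - x *\<^sub>R T)"
proof (rule power2_le_imp_le)
  have "T \<bullet> T = 1" using assms by (simp add: dot_square_norm)
  then have "(norm (d - x *\<^sub>R T))\<^sup>2 = (norm (perp_proj T d))\<^sup>2 + (x - T \<bullet> d)\<^sup>2"
    unfolding power2_norm_eq_inner perp_proj_def
    by (simp add: inner_diff_left inner_diff_right inner_commute[of d T] power2_eq_square
        algebra_simps)
  then show "(norm (perp_proj T d))\<^sup>2 \<le> (norm (d - x *\<^sub>R T))\<^sup>2" by simp
qed simp

section \<open>Curves of positive thickness\<close>

text \<open>Picks the lift of \<open>t\<close> closest to \<open>s\<close>, which reduces chord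
  estimates to half a period.\<close>

lemma int_shift_half:
  obtains n :: int where "\<bar>t + of_int n - s\<bar> \<le> (1/2::real)"
proof
  show "\<bar>t + of_int (- round (t - s)) - s\<bar> \<le> 1/2"
    using of_int_round_abs_le[of "t - s"] unfolding of_int_minus by linarith
qed

text \<open>\<open>D\<close> is a real lower bound for the thickness, not its value, so that even a
  hypothetical infinite thickness can be treated.\<close>

locale thick_curve =
  fixes \<gamma> :: curve and D :: real
  assumes C11: "C11_closed \<gamma>" and unit: "unit_speed \<gamma>"
    and D_pos: "0 < D" and thick: "ereal D \<le> thickness \<gamma>"
begin

lemma C1: "C1_closed \<gamma>"
  using C11 by (simp add: C11_closed_def)

lemma norm_velocity [simp]: "norm (velocity \<gamma> t) = 1"
  using unit by (simp add: unit_speed_def)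

lemma inner_velocity [simp]: "velocity \<gamma> t \<bullet> velocity \<gamma> t = 1"
  by (simp add: dot_square_norm)

lemma unit_tangent_eq [simp]: "unit_tangent \<gamma> = velocity \<gamma>"
  by (simp add: fun_eq_iff unit_tangent_def)

lemma r_tp_ge: "s - t \<notin> \<int> \<Longrightarrow> ereal D \<le> r_tp \<gamma> s t"
  using thick unfolding thickness_def by (force simp: le_INF_iff)

text \<open>The value 0 of \<open>r_tp\<close> on coinciding points is what excludes
  self-intersections.\<close>

lemma neq: "s - t \<notin> \<int> \<Longrightarrow> \<gamma> t \<noteq> \<gamma> s"
  using r_tp_ge[of s t] D_pos by (auto simp: r_tp_def)

lemma eq_if_Ints:
  assumes "s - t \<in> \<int>"
  shows "\<gamma> t = \<gamma> s"
proof -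
  obtain n where "s = t + of_int n" using assms 
    by (metis Ints_cases add.commute diff_add_cancel)
  then show ?thesis by (simp add: C1_closed_plus_of_int[OF C1])
qed

text \<open>Clearing denominators in \<open>D \<le> r_tp \<gamma> s t\<close> yields a form that
  also holds for parameters of the same point and for a chord along the tangent.\<close>

lemma perp_le: "2 * D * norm (perp_proj (velocity \<gamma> s) (\<gamma> t - \<gamma> s)) \<le> (norm (\<gamma> t - \<gamma> s))\<^sup>2"
proof (cases "perp_proj (velocity \<gamma> s) (\<gamma> t - \<gamma> s) = 0 \<or> s - t \<in> \<int>")
  case True
  then show ?thesis by (auto dest!: eq_if_Ints simp: perp_proj_def)
next
  case False
  then show ?thesis
    using r_tp_ge[of s t] neq[of s t] by (simp add: r_tp_def field_simps)
qed

lemma norm_chord_le: "norm (\<gamma> t - \<gamma> s) \<le> \<bar>t - s\<bar>"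
  using lipschitz_onD[OF lipschitz_on_of_vector_derivative_bound[of \<gamma> "velocity \<gamma>" 1], of t s]
    C1_closed_has_vector_derivative[OF C1] by (simp add: dist_norm)

text \<open>The chord differs from \<open>(t - s)\<close> times either end tangent by a normal part,
  at most \<open>(t - s)\<^sup>2 / (2 * D)\<close> by thickness, and a tangential part of third
  order. Comparing both ends gives the slope \<open>1 / D\<close> up to a quadratic error, which
  subdivision removes; the unspecified constant \<open>L\<close> enters only that error.\<close>

lemma velocity_lipschitz: "(1 / D)-lipschitz_on UNIV (velocity \<gamma>)"
proof -
  obtain L where L: "L-lipschitz_on UNIV (velocity \<gamma>)"
    using C11 by (auto simp: C11_closed_def)
  show ?thesis
  proof (rule lipschitz_on_if_quadratic_error[where B = "L\<^sup>2"])
    fix s t :: real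
    define d where "d = \<gamma> t - \<gamma> s"
    have along: "\<bar>t - s - velocity \<gamma> c \<bullet> d\<bar> \<le> \<bar>t - s\<bar> * (L\<^sup>2 * (t - s)\<^sup>2 / 2)"
      if c: "c \<in> closed_segment s t" for c
    proof -
      have "norm (\<gamma> t \<bullet> velocity \<gamma> c - \<gamma> s \<bullet> velocity \<gamma> c
              - (t - s) *\<^sub>R (velocity \<gamma> c \<bullet> velocity \<gamma> c))
          \<le> norm (t - s) * (L\<^sup>2 * (t - s)\<^sup>2 / 2)"
      proof (rule vector_differentiable_bound_linearization[of "closed_segment s t"
            "\<lambda>u. \<gamma> u \<bullet> velocity \<gamma> c" "\<lambda>u. velocity \<gamma> u \<bullet> velocity \<gamma> c"])
        fix u assume u: "u \<in> closed_segment s t"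
        show "((\<lambda>u. \<gamma> u \<bullet> velocity \<gamma> c) has_vector_derivative velocity \<gamma> u \<bullet> velocity \<gamma> c)
            (at u within closed_segment s t)"
          by (intro bounded_linear.has_vector_derivative[OF bounded_linear_inner_left]
              C1_closed_has_vector_derivative C1)
        have "\<bar>u - c\<bar> \<le> \<bar>t - s\<bar>"
          using u c by (auto simp: closed_segment_eq_real_ivl split: if_splits)
        then have "L * \<bar>u - c\<bar> \<le> L * \<bar>t - s\<bar>"
          using lipschitz_on_nonneg[OF L] by (rule mult_left_mono)
        then have "norm (velocity \<gamma> u - velocity \<gamma> c) \<le> L * \<bar>t - s\<bar>"
          using lipschitz_onD[OF L, of u c] by (simp add: dist_norm)
        then have "(norm (velocity \<gamma> u - velocity \<gamma> c))\<^sup>2 \<le> L\<^sup>2 * (t - s)\<^sup>2"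
          by (metis norm_ge_zero power2_abs power_mono power_mult_distrib)
        \<comment> \<open>For unit vectors the defect of the inner product from 1 is half the
          squared distance, hence of second order; integrating along the chord gains one more
          order.\<close>
        moreover have "(norm (velocity \<gamma> u - velocity \<gamma> c))\<^sup>2 = 2 * (1 - velocity \<gamma> u \<bullet> velocity \<gamma> c)"
          by (simp add: power2_norm_eq_inner inner_diff_left inner_diff_right inner_commute)
        moreover have "0 \<le> (norm (velocity \<gamma> u - velocity \<gamma> c))\<^sup>2" by simp
        ultimately show "norm (velocity \<gamma> u \<bullet> velocity \<gamma> c - velocity \<gamma> c \<bullet> velocity \<gamma> c)
            \<le> L\<^sup>2 * (t - s)\<^sup>2 / 2"
          by (simp add: abs_le_iff)
      qed (use c in auto)
      then show ?thesis
        by (simp add: d_def inner_diff_right inner_commute abs_minus_commute)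
    qed
    have tangent: "norm (d - (t - s) *\<^sub>R velocity \<gamma> c)
        \<le> (t - s)\<^sup>2 / (2 * D) + \<bar>t - s\<bar> * (L\<^sup>2 * (t - s)\<^sup>2 / 2)" if c: "c = s \<or> c = t" for c
    proof -
      have "2 * D * norm (perp_proj (velocity \<gamma> c) d) \<le> (norm d)\<^sup>2"
      proof (cases "c = s")
        case True
        then show ?thesis using perp_le by (simp add: d_def)
      next
        case False
        \<comment> \<open>At the end \<open>t\<close> thickness speaks of the reversed chord; the
          projection is odd.\<close>
        have "perp_proj (velocity \<gamma> c) d = - perp_proj (velocity \<gamma> c) (- d)"
          by (simp add: perp_proj_def)
        then have "norm (perp_proj (velocity \<gamma> c) d) = norm (perp_proj (velocity \<gamma> c) (- d))"
          by (metis norm_minus_cancel)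
        then show ?thesis
          using False c perp_le[of t s] by (simp add: d_def norm_minus_commute)
      qed
      also have "(norm d)\<^sup>2 \<le> (t - s)\<^sup>2"
        using norm_chord_le[of t s] by (metis d_def norm_ge_zero power2_abs power_mono)
      finally have "norm (perp_proj (velocity \<gamma> c) d) \<le> (t - s)\<^sup>2 / (2 * D)"
        using D_pos by (simp add: field_simps)
      moreover have "norm ((t - s - velocity \<gamma> c \<bullet> d) *\<^sub>R velocity \<gamma> c)
          \<le> \<bar>t - s\<bar> * (L\<^sup>2 * (t - s)\<^sup>2 / 2)"
        using along[of c] c by auto
      moreover have "d - (t - s) *\<^sub>R velocity \<gamma> c
          = perp_proj (velocity \<gamma> c) d - (t - s - velocity \<gamma> c \<bullet> d) *\<^sub>R velocity \<gamma> c"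
        by (simp add: perp_proj_def algebra_simps)
      ultimately show ?thesis
        using norm_triangle_ineq4[of "perp_proj (velocity \<gamma> c) d"
            "(t - s - velocity \<gamma> c \<bullet> d) *\<^sub>R velocity \<gamma> c"] by simp
    qed
    \<comment> \<open>Subtracting the two linearization errors cancels the chord and leaves the
      difference of the tangents.\<close>
    have "\<bar>t - s\<bar> * norm (velocity \<gamma> t - velocity \<gamma> s)
        = norm ((d - (t - s) *\<^sub>R velocity \<gamma> s) - (d - (t - s) *\<^sub>R velocity \<gamma> t))"
      by (simp flip: norm_scaleR) (simp add: algebra_simps)
    also have "\<dots> \<le> 2 * ((t - s)\<^sup>2 / (2 * D) + \<bar>t - s\<bar> * (L\<^sup>2 * (t - s)\<^sup>2 / 2))"
      using norm_triangle_ineq4[of "d - (t - s) *\<^sub>R velocity \<gamma> s" "d - (t - s) *\<^sub>R velocity \<gamma> t"]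
        tangent[of s] tangent[of t] by simp
    also have "\<dots> = \<bar>t - s\<bar> * (1 / D * \<bar>t - s\<bar> + L\<^sup>2 * (t - s)\<^sup>2)"
      by (simp add: distrib_left power2_eq_square)
    finally show "norm (velocity \<gamma> t - velocity \<gamma> s) \<le> 1 / D * \<bar>t - s\<bar> + L\<^sup>2 * (t - s)\<^sup>2"
      by (cases "t = s") (simp_all add: mult_le_cancel_left_pos)
  qed (use D_pos in simp)
qed

text \<open>By Rolle, the tangent turns by a right angle within half a period.\<close>

lemma D_le_half: "D \<le> 1/2"
proof -
  define f where "f u = \<gamma> u \<bullet> velocity \<gamma> 0" for u
  have der: "(f has_real_derivative velocity \<gamma> u \<bullet> velocity \<gamma> 0) (at u)" for u
    unfolding f_def has_real_derivative_iff_has_vector_derivative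
    by (intro bounded_linear.has_vector_derivative[OF bounded_linear_inner_left]
        C1_closed_has_vector_derivative C1)
  have "\<exists>z. - (1/2) < z \<and> z < 1/2 \<and> (f has_real_derivative 0) (at z)"
  proof (rule Rolle)
    show "f (- (1/2)) = f (1/2)"
      using C1_closed_plus_1[OF C1, of "- (1/2)"] by (simp add: f_def)
    show "continuous_on {- (1/2)..1/2} f"
      by (rule DERIV_continuous_on[OF has_field_derivative_at_within[OF der]])
    show "f differentiable (at x)" for x
      using der real_differentiable_def by blast
  qed simp
  then obtain z where "- (1/2) < z" "z < 1/2" and dz: "(f has_real_derivative 0) (at z)"
    by blast
  then have z: "\<bar>z\<bar> < 1/2" by linarith
  from der dz have orth: "velocity \<gamma> z \<bullet> velocity \<gamma> 0 = 0"
    by (meson DERIV_unique)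
  \<comment> \<open>Orthogonal unit vectors are at distance sqrt 2; the bound 1 is enough.\<close>
  have "1 \<le> norm (velocity \<gamma> z - velocity \<gamma> 0)"
  proof (rule power2_le_imp_le)
    show "1\<^sup>2 \<le> (norm (velocity \<gamma> z - velocity \<gamma> 0))\<^sup>2"
      using orth by (simp add: power2_norm_eq_inner inner_diff_left inner_diff_right inner_commute)
  qed simp
  also have "\<dots> \<le> 1 / D * \<bar>z\<bar>"
    using lipschitz_onD[OF velocity_lipschitz, of z 0] by (simp add: dist_norm)
  finally have "D \<le> \<bar>z\<bar>" using D_pos by (simp add: field_simps)
  with z show ?thesis by simp
qed

text \<open>On such a short arc the linearization error \<open>(t - s)\<^sup>2 / D\<close> consumes
  at most half of the arc length.\<close>

lemma chord_near:
  assumes "\<bar>t - s\<bar> \<le> D / 2"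
  shows "\<bar>t - s\<bar> / 2 \<le> norm (\<gamma> t - \<gamma> s)"
proof -
  have "\<bar>t - s\<bar> = norm ((t - s) *\<^sub>R velocity \<gamma> s)" by simp
  also have "\<dots> \<le> norm (\<gamma> t - \<gamma> s) + norm (\<gamma> t - \<gamma> s - (t - s) *\<^sub>R velocity \<gamma> s)"
    using norm_triangle_ineq4[of "\<gamma> t - \<gamma> s" "\<gamma> t - \<gamma> s - (t - s) *\<^sub>R velocity \<gamma> s"] by simp
  also have "norm (\<gamma> t - \<gamma> s - (t - s) *\<^sub>R velocity \<gamma> s) \<le> 1 / D * (t - s)\<^sup>2"
    by (rule norm_chord_linearization_le[OF C1 velocity_lipschitz])
  also have "1 / D * (t - s)\<^sup>2 = \<bar>t - s\<bar> * (\<bar>t - s\<bar> / D)"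
    by (simp add: power2_eq_square)
  also have "\<dots> \<le> \<bar>t - s\<bar> * (1/2)"
    using assms D_pos by (intro mult_left_mono) (auto simp: field_simps)
  finally show ?thesis by simp
qed

text \<open>At an interior minimum of the distance to \<open>\<gamma> s\<close> the chord is perpendicular to the
  tangent, so \<open>r_tp\<close> equals half the chord length there.\<close>

lemma chord_far:
  assumes t: "D / 2 \<le> t - s" "t - s \<le> 1 - D / 2"
  shows "D / 4 \<le> norm (\<gamma> t - \<gamma> s)"
proof -
  \<comment> \<open>Over one period, \<open>I\<close> holds the parameters at circle distance at
    least \<open>D / 2\<close> from \<open>s\<close>.\<close>
  define I where "I = {s + D / 2..s + 1 - D / 2}"
  define f where "f u = (\<gamma> u - \<gamma> s) \<bullet> (\<gamma> u - \<gamma> s)" for u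
  have "continuous_on I f"
    unfolding f_def by (intro continuous_intros C1_closed_continuous_on C1)
  moreover have "I \<noteq> {}" "t \<in> I" using t by (auto simp: I_def)
  ultimately obtain u where u: "u \<in> I" and min: "\<And>v. v \<in> I \<Longrightarrow> f u \<le> f v"
    using continuous_attains_inf[of I f] by (auto simp: I_def)
  have "D / 4 \<le> norm (\<gamma> u - \<gamma> s)"
  \<comment> \<open>Both endpoints have circle distance \<open>D / 2\<close> from \<open>s\<close>,
    where \<open>chord_near\<close> gives exactly \<open>D / 4\<close>.\<close>
  proof (cases "u = s + D / 2 \<or> u = s + 1 - D / 2")
    case True
    then show ?thesis
    proof
      assume "u = s + D / 2"
      then show ?thesis using chord_near[of u s] D_pos by simp
    next
      assume "u = s + 1 - D / 2"
      then have "u = s - D / 2 + 1" by simp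
      then have "\<gamma> u = \<gamma> (s - D / 2)"
        using C1_closed_plus_1[OF C1] by simp
      then show ?thesis
        using chord_near[of "s - D / 2" s] D_pos by simp
    qed
  next
    case False
    with u have u': "s + D / 2 < u" "u < s + 1 - D / 2" by (auto simp: I_def)
    have "(f has_real_derivative 2 * (velocity \<gamma> u \<bullet> (\<gamma> u - \<gamma> s))) (at u)"
      unfolding f_def has_real_derivative_iff_has_vector_derivative has_vector_derivative_def
      by (auto intro!: derivative_eq_intros
          C1_closed_has_vector_derivative[OF C1, unfolded has_vector_derivative_def]
          simp: inner_commute algebra_simps)
    moreover have "f u \<le> f v" if "\<bar>u - v\<bar> < min (u - (s + D / 2)) (s + 1 - D / 2 - u)" for v
      using that by (intro min) (auto simp: I_def)
    ultimately have "2 * (velocity \<gamma> u \<bullet> (\<gamma> u - \<gamma> s)) = 0"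
      using u' by (intro DERIV_local_min[where d = "min (u - (s + D / 2)) (s + 1 - D / 2 - u)"]) auto
    then have orth: "velocity \<gamma> u \<bullet> (\<gamma> s - \<gamma> u) = 0" by (simp add: inner_diff_right)
    have "u - s \<notin> \<int>"
      using u' D_pos Ints_nonzero_abs_less1[of "u - s"] by auto
    then have "\<gamma> s \<noteq> \<gamma> u" by (rule neq)
    then have "2 * D \<le> norm (\<gamma> s - \<gamma> u)"
      using perp_le[of u s] by (simp add: perp_proj_def orth power2_eq_square)
    then show ?thesis using D_pos by (simp add: norm_minus_commute)
  qed
  also have "norm (\<gamma> u - \<gamma> s) \<le> norm (\<gamma> t - \<gamma> s)"
    using min[OF \<open>t \<in> I\<close>] unfolding f_def norm_le .
  finally show ?thesis .
qed

text \<open>The near and far bounds meet at \<open>\<bar>t - s\<bar> = D / 2\<close>, where both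
  equal \<open>D / 4\<close>.\<close>

lemma chord_ge:
  assumes "\<bar>t - s\<bar> \<le> 1/2"
  shows "min (\<bar>t - s\<bar> / 2) (D / 4) \<le> norm (\<gamma> t - \<gamma> s)"
proof (cases "\<bar>t - s\<bar> \<le> D / 2")
  case True
  then show ?thesis using chord_near by auto
next
  case False
  \<comment> \<open>\<open>D_le_half\<close> ensures \<open>1/2 \<le> 1 - D / 2\<close>, so the far
    bound covers the rest of the half period.\<close>
  then have "D / 4 \<le> norm (\<gamma> t - \<gamma> s)"
    using assms D_le_half chord_far[of s t] chord_far[of t s]
    by (cases "s \<le> t") (auto simp: norm_minus_commute)
  then show ?thesis by simp
qed

end

section \<open>Small perturbations\<close>

text \<open>The isotopy is the straight-line homotopy: for each \<open>\<theta>\<close> in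
  \<open>[0, 1]\<close> the stage \<open>x + \<theta> *\<^sub>R V x\<close> is the identity plus a
  contraction.\<close>

lemma ambient_isotopic_displacement:
  fixes V :: "real^3 \<Rightarrow> real^3"
  assumes V: "k-lipschitz_on UNIV V" and k: "k < 1" and \<eta>: "\<And>t. \<eta> t = \<gamma> t + V (\<gamma> t)"
  shows "ambient_isotopic \<gamma> \<eta>"
proof -
  have k0: "0 \<le> k" using V by (rule lipschitz_on_nonneg)
  let ?H = "\<lambda>(\<theta>::real, x). x + \<theta> *\<^sub>R V x"
  have "homotopic_with_canon (\<lambda>f. \<exists>g. homeomorphism UNIV UNIV f g) UNIV UNIV id (\<lambda>x. x + V x)"
    unfolding homotopic_with_def
  proof (intro exI[of _ ?H] conjI allI ballI)
    have "continuous_on UNIV V" using V by (rule lipschitz_on_continuous_on)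
    then have "continuous_on ({0..1} \<times> UNIV) ?H"
      unfolding case_prod_beta
      by (intro continuous_intros continuous_on_compose2[of UNIV V _ snd]) auto
    then show "continuous_map (prod_topology (top_of_set {0..1}) (top_of_set UNIV)) (top_of_set UNIV) ?H"
      by (simp add: subtopology_Times[symmetric] euclidean_product_topology flip: subtopology_UNIV)
  next
    fix \<theta> :: real assume "\<theta> \<in> {0..1}"
    then have \<theta>: "\<bar>\<theta>\<bar> * k \<le> 1 * k" "\<bar>\<theta>\<bar> * k < 1"
      using k k0 mult_right_mono[of "\<bar>\<theta>\<bar>" 1 k] by auto
    have "(\<bar>\<theta>\<bar> * k)-lipschitz_on UNIV (\<lambda>x. \<theta> *\<^sub>R V x)"
      by (intro lipschitz_intros V)
    from homeomorphism_id_plus_contraction[OF this \<theta>(2)]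
    show "\<exists>g. homeomorphism UNIV UNIV (\<lambda>x. ?H (\<theta>, x)) g" by simp
  qed auto
  then show ?thesis
    unfolding ambient_isotopic_def using \<eta> by (intro exI[of _ "\<lambda>x. x + V x"]) (auto simp: fun_eq_iff)
qed

text \<open>\<open>\<mu>\<close> stands for \<open>r * \<epsilon>\<close>. As \<open>h\<close> has
  Lipschitz constant \<open>2 * M / D\<close> with respect to chords of \<open>\<gamma>\<close>, the
  16 makes the displacement 1/8-Lipschitz.\<close>

locale perturbed_thick_curve = thick_curve +
  fixes h :: curve and M \<mu> :: real
  assumes h_C1: "C1_closed h" and M_ge_1: "1 \<le> M"
    and h_lipschitz: "M-lipschitz_on UNIV h"
    and h'_lipschitz: "M-lipschitz_on UNIV (velocity h)"
    and h'_le: "norm (velocity h t) \<le> M"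
    and \<mu>_le: "\<bar>\<mu>\<bar> \<le> D / (16 * M)"
begin

definition \<eta> :: curve where
  "\<eta> t = \<gamma> t + \<mu> *\<^sub>R h t"

lemma \<mu>_M: "\<bar>\<mu>\<bar> * M \<le> D / 16"
  using \<mu>_le M_ge_1 by (simp add: field_simps)

text \<open>This is the Lipschitz bound for \<open>h \<circ> \<gamma>\<^sup>-\<^sup>1\<close>,
  phrased in parameters; it also shows that \<open>h t\<close> depends only on the point
  \<open>\<gamma> t\<close>.\<close>

lemma h_diff_le: "norm (h t - h s) \<le> 2 * M / D * norm (\<gamma> t - \<gamma> s)"
proof -
  obtain n where n: "\<bar>t + of_int n - s\<bar> \<le> 1/2" by (rule int_shift_half)
  define \<tau> where "\<tau> = \<bar>t + of_int n - s\<bar>"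
  have \<tau>: "0 \<le> \<tau>" "\<tau> \<le> 1/2" using n by (auto simp: \<tau>_def)
  \<comment> \<open>The right side is \<open>\<tau> / D\<close> for short arcs, where
    \<open>D \<le> 1/2\<close> helps, and 1/2 otherwise.\<close>
  have "\<tau> \<le> 2 / D * min (\<tau> / 2) (D / 4)"
  proof (cases "\<tau> \<le> D / 2")
    case True
    have "D * \<tau> \<le> 1 * \<tau>" using \<tau> D_le_half by (intro mult_right_mono) auto
    with True D_pos show ?thesis by (simp add: min_def field_simps)
  next
    case False
    with \<tau> D_pos show ?thesis by (simp add: min_def)
  qed
  also have "\<dots> \<le> 2 / D * norm (\<gamma> t - \<gamma> s)"
    using chord_ge[OF n] D_pos
    by (intro mult_left_mono) (auto simp: \<tau>_def C1_closed_plus_of_int[OF C1])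
  finally have "M * \<tau> \<le> M * (2 / D * norm (\<gamma> t - \<gamma> s))"
    using M_ge_1 by (intro mult_left_mono) auto
  moreover have "norm (h t - h s) \<le> M * \<tau>"
    using lipschitz_onD[OF h_lipschitz, of "t + of_int n" s]
    by (simp add: dist_norm \<tau>_def C1_closed_plus_of_int[OF h_C1])
  ultimately show ?thesis by (simp add: mult_ac)
qed

text \<open>The factor 1/8 serves twice: chords keep at least half their length, and the
  displacement still extends to a contraction of space.\<close>

lemma \<mu>_h_diff_le: "norm (\<mu> *\<^sub>R (h t - h s)) \<le> norm (\<gamma> t - \<gamma> s) / 8"
proof -
  have "norm (\<mu> *\<^sub>R (h t - h s)) \<le> \<bar>\<mu>\<bar> * (2 * M / D * norm (\<gamma> t - \<gamma> s))"
    unfolding norm_scaleR by (intro mult_left_mono h_diff_le) simp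
  also have "\<dots> = (\<bar>\<mu>\<bar> * M) * (2 / D * norm (\<gamma> t - \<gamma> s))" by simp
  also have "\<dots> \<le> D / 16 * (2 / D * norm (\<gamma> t - \<gamma> s))"
    using \<mu>_M D_pos by (intro mult_right_mono) auto
  also have "\<dots> = norm (\<gamma> t - \<gamma> s) / 8" using D_pos by simp
  finally show ?thesis .
qed

section \<open>Velocity, regularity and length of the perturbed curve\<close>

lemma \<eta>_has_vector_derivative:
  "(\<eta> has_vector_derivative velocity \<gamma> t + \<mu> *\<^sub>R velocity h t) (at t)"
  unfolding \<eta>_def[abs_def]
  by (auto intro!: derivative_eq_intros C1_closed_has_vector_derivative C1 h_C1)

lemma velocity_\<eta>: "velocity \<eta> t = velocity \<gamma> t + \<mu> *\<^sub>R velocity h t"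
  using \<eta>_has_vector_derivative by (simp add: velocity_def[of \<eta>] vector_derivative_at)

lemma \<eta>_C1: "C1_closed \<eta>"
  unfolding C1_closed_def
proof
  show "periodic_fun_simple' \<eta>"
    by standard (simp add: \<eta>_def C1_closed_plus_1 C1 h_C1)
  show "\<eta> C1_differentiable_on UNIV"
    unfolding C1_differentiable_on_def using \<eta>_has_vector_derivative
      C1_closed_continuous_on(2)[OF C1] C1_closed_continuous_on(2)[OF h_C1]
    by (intro exI[of _ "\<lambda>t. velocity \<gamma> t + \<mu> *\<^sub>R velocity h t"]) (auto intro!: continuous_intros)
qed

lemma \<eta>_velocity_lipschitz: "(2 / D)-lipschitz_on UNIV (velocity \<eta>)"
proof -
  \<comment> \<open>Since \<open>D \<le> 1/2\<close>, the contribution of \<open>h\<close> is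
    absorbed by a second \<open>1 / D\<close>.\<close>
  have "D / 16 \<le> 1 / D"
    using D_pos D_le_half mult_mono[of D "1/2" D "1/2"] by (simp add: field_simps)
  then have "1 / D + \<bar>\<mu>\<bar> * M \<le> 2 / D"
    using \<mu>_M by (simp add: field_simps)
  moreover have "(1 / D + \<bar>\<mu>\<bar> * M)-lipschitz_on UNIV (velocity \<eta>)"
    unfolding velocity_\<eta>[abs_def] by (intro lipschitz_intros velocity_lipschitz h'_lipschitz)
  ultimately show ?thesis using lipschitz_on_mono by blast
qed

lemma \<eta>_C11: "C11_closed \<eta>"
  using \<eta>_C1 \<eta>_velocity_lipschitz by (auto simp: C11_closed_def)

lemma norm_\<mu>_h': "norm (\<mu> *\<^sub>R velocity h t) \<le> 1/32"
proof -
  have "norm (\<mu> *\<^sub>R velocity h t) \<le> \<bar>\<mu>\<bar> * M"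
    using h'_le by (simp add: mult_left_mono)
  then show ?thesis using \<mu>_M D_le_half by linarith
qed

lemma \<eta>_regular: "regular_curve \<eta>"
proof -
  have "velocity \<eta> t \<noteq> 0" for t
  proof
    assume "velocity \<eta> t = 0"
    then have "velocity \<gamma> t = - (\<mu> *\<^sub>R velocity h t)"
      by (simp add: velocity_\<eta> eq_neg_iff_add_eq_0)
    then have "1 = norm (\<mu> *\<^sub>R velocity h t)"
      by (metis norm_minus_cancel norm_velocity)
    then show False using norm_\<mu>_h'[of t] by simp
  qed
  then show ?thesis by (simp add: regular_curve_def)
qed

lemma curve_length_\<eta>: "curve_length \<eta> \<le> 2"
proof -
  have "curve_length \<eta> \<le> integral {0..1} (\<lambda>t::real. 2::real)"
    unfolding curve_length_def
  proof (rule integral_le)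
    show "(\<lambda>t. norm (velocity \<eta> t)) integrable_on {0..1}"
      by (intro integrable_continuous_interval continuous_intros C1_closed_continuous_on \<eta>_C1)
    show "norm (velocity \<eta> t) \<le> 2" for t
      using norm_triangle_ineq[of "velocity \<gamma> t" "\<mu> *\<^sub>R velocity h t"] norm_\<mu>_h'[of t]
        norm_velocity[of t] unfolding velocity_\<eta> by linarith
  qed auto
  then show ?thesis by simp
qed

section \<open>Chords, embeddedness and thickness of the perturbed curve\<close>

lemma \<eta>_chord_ge: "norm (\<gamma> t - \<gamma> s) / 2 \<le> norm (\<eta> t - \<eta> s)"
proof -
  have "norm (\<mu> *\<^sub>R (h t - h s)) \<le> norm (\<gamma> t - \<gamma> s) / 2"
    using \<mu>_h_diff_le[of t s] norm_ge_zero[of "\<gamma> t - \<gamma> s"] by linarith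
  moreover have "\<gamma> t - \<gamma> s = (\<eta> t - \<eta> s) - \<mu> *\<^sub>R (h t - h s)"
    by (simp add: \<eta>_def algebra_simps)
  ultimately show ?thesis
    using norm_triangle_ineq4[of "\<eta> t - \<eta> s" "\<mu> *\<^sub>R (h t - h s)"] by simp
qed

lemma \<eta>_embedded: "embedded_curve \<eta>"
  unfolding embedded_curve_def
proof (rule inj_onI)
  fix s t :: real assume st: "s \<in> {0..<1}" "t \<in> {0..<1}" and "\<eta> s = \<eta> t"
  then have "\<gamma> t = \<gamma> s" using \<eta>_chord_ge[of t s] by simp
  then have "s - t \<in> \<int>" using neq by blast
  then show "s = t" using st Ints_nonzero_abs_less1[of "s - t"] by auto
qed

text \<open>On short arcs the normal part is at most \<open>2 / D * (t - s)\<^sup>2\<close> and the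
  chord at least \<open>\<bar>t - s\<bar> / 4\<close>, which dictates the 32. On long arcs the
  normal part is at most the chord, and the chord is at least \<open>D / 8\<close>.\<close>

lemma \<eta>_perp_le:
  "D / 32 * norm (perp_proj (unit_tangent \<eta> s) (\<eta> t - \<eta> s)) \<le> (norm (\<eta> t - \<eta> s))\<^sup>2"
proof -
  have "D / 32 * norm (perp_proj (unit_tangent \<eta> s) (\<eta> t - \<eta> s)) \<le> (norm (\<eta> t - \<eta> s))\<^sup>2"
    if ts: "\<bar>t - s\<bar> \<le> 1/2" for t
  proof -
    have nz: "velocity \<eta> s \<noteq> 0" using \<eta>_regular by (simp add: regular_curve_def)
    then have unit: "norm (unit_tangent \<eta> s) = 1" by (simp add: unit_tangent_def)
    show ?thesis
    proof (cases "\<bar>t - s\<bar> \<le> D / 2")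
      case True
      have "\<bar>t - s\<bar> \<le> 4 * norm (\<eta> t - \<eta> s)"
        using chord_near[OF True] \<eta>_chord_ge[of t s] by simp
      then have "(t - s)\<^sup>2 \<le> (4 * norm (\<eta> t - \<eta> s))\<^sup>2"
        by (metis abs_ge_zero power2_abs power_mono)
      then have sq: "(t - s)\<^sup>2 \<le> 16 * (norm (\<eta> t - \<eta> s))\<^sup>2"
        by (simp add: power_mult_distrib)
      \<comment> \<open>The comparison point on the tangent line is the first-order step
        \<open>(t - s) *\<^sub>R velocity \<eta> s\<close>, so that the linearization bound
        applies.\<close>
      have "norm (perp_proj (unit_tangent \<eta> s) (\<eta> t - \<eta> s))
          \<le> norm (\<eta> t - \<eta> s - ((t - s) * norm (velocity \<eta> s)) *\<^sub>R unit_tangent \<eta> s)"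
        by (rule norm_perp_proj_le[OF unit])
      also have "((t - s) * norm (velocity \<eta> s)) *\<^sub>R unit_tangent \<eta> s = (t - s) *\<^sub>R velocity \<eta> s"
        using nz by (simp add: unit_tangent_def)
      also have "norm (\<eta> t - \<eta> s - (t - s) *\<^sub>R velocity \<eta> s) \<le> 2 / D * (t - s)\<^sup>2"
        by (rule norm_chord_linearization_le[OF \<eta>_C1 \<eta>_velocity_lipschitz])
      finally have "D / 32 * norm (perp_proj (unit_tangent \<eta> s) (\<eta> t - \<eta> s))
          \<le> D / 32 * (2 / D * (t - s)\<^sup>2)"
        using D_pos by (intro mult_left_mono) auto
      also have "\<dots> = (t - s)\<^sup>2 / 16" using D_pos by simp
      finally show ?thesis using sq by simp
    next
      case False
      then have "D / 4 \<le> norm (\<gamma> t - \<gamma> s)"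
        using chord_ge[OF ts] by simp
      then have "D / 32 \<le> norm (\<eta> t - \<eta> s)"
        using \<eta>_chord_ge[of t s] D_pos by simp
      moreover have "norm (perp_proj (unit_tangent \<eta> s) (\<eta> t - \<eta> s)) \<le> norm (\<eta> t - \<eta> s)"
        using norm_perp_proj_le[OF unit, of _ 0] by simp
      ultimately show ?thesis
        unfolding power2_eq_square by (intro mult_mono) auto
    qed
  qed
  note near = this
  \<comment> \<open>Both sides are periodic in \<open>t\<close>, so the nearest lift may be
    used.\<close>
  obtain n where "\<bar>t + of_int n - s\<bar> \<le> 1/2" by (rule int_shift_half)
  from near[OF this] show ?thesis by (simp add: C1_closed_plus_of_int[OF \<eta>_C1])
qed

text \<open>The 2 in the denominator of \<open>r_tp\<close> turns \<open>D / 32\<close> into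
  \<open>D / 64\<close>.\<close>

lemma \<eta>_thickness: "ereal (D / 64) \<le> thickness \<eta>"
proof -
  have "ereal (D / 64) \<le> r_tp \<eta> s t" if "s - t \<notin> \<int>" for s t
  proof -
    have "\<eta> t \<noteq> \<eta> s"
      using neq[OF that] \<eta>_chord_ge[of t s] by auto
    then show ?thesis
      using \<eta>_perp_le[of s t] by (simp add: r_tp_def field_simps)
  qed
  then show ?thesis unfolding thickness_def by (auto simp: le_INF_iff)
qed

lemma \<eta>_ropelength: "ropelength \<eta> \<le> ereal (128 / D)"
proof (cases "thickness \<eta>")
  case (real k)
  then have k: "D / 64 \<le> k" using \<eta>_thickness by simp
  then have "0 < k" using D_pos by simp
  \<comment> \<open>Length at most 2 over thickness at least \<open>D / 64\<close> explains the
    128.\<close>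
  have "curve_length \<eta> / k \<le> 2 / (D / 64)"
    using curve_length_\<eta> k D_pos \<open>0 < k\<close> by (intro frac_le) auto
  then show ?thesis using real \<open>0 < k\<close> by (simp add: ropelength_def)
next
  \<comment> \<open>A finite length divided by infinite thickness is 0.\<close>
  case PInf
  then show ?thesis using D_pos by (simp add: ropelength_def)
next
  case MInf
  then show ?thesis using \<eta>_thickness by simp
qed

text \<open>The displacement \<open>\<mu> h \<circ> \<gamma>\<^sup>-\<^sup>1\<close> on the curve is a contraction and extends to one on space.\<close>

lemma \<eta>_ambient_isotopic: "ambient_isotopic \<gamma> \<eta>"
proof -
  \<comment> \<open>An arbitrary preimage will do: by \<open>h_diff_le\<close> all parameters of one
    point give the same value of \<open>h\<close>.\<close>
  define f where "f x = \<mu> *\<^sub>R h (SOME t. \<gamma> t = x)" for x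
  have f: "f (\<gamma> t) = \<mu> *\<^sub>R h t" for t
  proof -
    have "\<gamma> (SOME u. \<gamma> u = \<gamma> t) = \<gamma> t" by (rule someI) simp
    then have "h (SOME u. \<gamma> u = \<gamma> t) = h t"
      using h_diff_le[of "SOME u. \<gamma> u = \<gamma> t" t] by simp
    then show ?thesis by (simp add: f_def)
  qed
  have "(1/8)-lipschitz_on (range \<gamma>) f"
  proof (rule lipschitz_onI)
    fix x y assume "x \<in> range \<gamma>" "y \<in> range \<gamma>"
    then obtain s t where st: "x = \<gamma> t" "y = \<gamma> s" by blast
    show "dist (f x) (f y) \<le> 1/8 * dist x y"
      using \<mu>_h_diff_le[of t s] by (simp add: st f dist_norm scaleR_diff_right)
  qed simp
  then obtain V where V: "(real CARD(3) * (1/8))-lipschitz_on UNIV V"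
    and V_eq: "\<And>x. x \<in> range \<gamma> \<Longrightarrow> V x = f x"
    by (rule lipschitz_extension_vec) blast
  show ?thesis
    by (rule ambient_isotopic_displacement[OF V]) (simp_all add: V_eq f \<eta>_def)
qed

end

section \<open>Choice of the constants and assembly\<close>

theorem lemma6p1:
  fixes h :: "real \<Rightarrow> real^3"
  assumes "C2_closed h"
  shows "\<exists>a_h c_h C_h :: real. a_h > 0 \<and> c_h > 0 \<and> C_h > 0 \<and>
    (\<forall>(\<gamma> :: real \<Rightarrow> real^3) (\<epsilon> :: real).
      C11_closed \<gamma> \<and> unit_speed \<gamma> \<and> embedded_curve \<gamma> \<and> curve_length \<gamma> = 1 \<and>
      thickness \<gamma> > 0 \<and> ereal \<bar>\<epsilon>\<bar> \<le> ereal a_h * thickness \<gamma> \<longrightarrow>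
      (\<forall>r \<in> {-1..1}. let \<eta> = (\<lambda>t. \<gamma> t + (r * \<epsilon>) *\<^sub>R h t) in
        C11_closed \<eta> \<and> regular_curve \<eta> \<and> embedded_curve \<eta> \<and>
        ambient_isotopic \<gamma> \<eta> \<and>
        thickness \<eta> \<ge> ereal c_h * thickness \<gamma> \<and>
        ropelength \<eta> \<le> ereal C_h / thickness \<gamma>))"
proof -
  obtain M where M: "1 \<le> M" "M-lipschitz_on UNIV h" "M-lipschitz_on UNIV (velocity h)"
    "\<And>t. norm (velocity h t) \<le> M"
    using C2_closed_bound[OF assms] by blast
  show ?thesis
  proof (intro exI conjI allI impI ballI)
    \<comment> \<open>Only \<open>a_h\<close> depends on \<open>h\<close>, through \<open>M\<close>;
      the other two constants are absolute.\<close>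
    show "0 < 1 / (16 * M)" "0 < (1/64 :: real)" "0 < (128 :: real)" using M by auto
  next
    fix \<gamma> :: curve and \<epsilon> r :: real
    assume *: "C11_closed \<gamma> \<and> unit_speed \<gamma> \<and> embedded_curve \<gamma> \<and> curve_length \<gamma> = 1 \<and>
      thickness \<gamma> > 0 \<and> ereal \<bar>\<epsilon>\<bar> \<le> ereal (1 / (16 * M)) * thickness \<gamma>"
      and r: "r \<in> {-1..1}"
    \<comment> \<open>Infinite thickness would admit the lower bound 1, contradicting
      \<open>D_le_half\<close>.\<close>
    have "thickness \<gamma> \<noteq> \<infinity>"
    proof
      assume "thickness \<gamma> = \<infinity>"
      then interpret thick_curve \<gamma> 1 by unfold_locales (use * in auto)
      show False using D_le_half by simp
    qed
    then obtain D where D: "thickness \<gamma> = ereal D" "0 < D"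
      using * by (cases "thickness \<gamma>") auto
    have "\<bar>\<epsilon>\<bar> \<le> D / (16 * M)" using * D by simp
    moreover have "\<bar>r * \<epsilon>\<bar> \<le> 1 * \<bar>\<epsilon>\<bar>"
      using r unfolding abs_mult by (intro mult_right_mono) auto
    ultimately interpret perturbed_thick_curve \<gamma> D h M "r * \<epsilon>"
      using * D M assms by unfold_locales (auto simp: C2_closed_def)
    have "(\<lambda>t. \<gamma> t + (r * \<epsilon>) *\<^sub>R h t) = \<eta>" by (simp add: fun_eq_iff \<eta>_def)
    then show "let \<eta> = (\<lambda>t. \<gamma> t + (r * \<epsilon>) *\<^sub>R h t) in
        C11_closed \<eta> \<and> regular_curve \<eta> \<and> embedded_curve \<eta> \<and>
        ambient_isotopic \<gamma> \<eta> \<and>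
        thickness \<eta> \<ge> ereal (1/64) * thickness \<gamma> \<and>
        ropelength \<eta> \<le> ereal 128 / thickness \<gamma>"
      using \<eta>_C11 \<eta>_regular \<eta>_embedded \<eta>_ambient_isotopic \<eta>_thickness \<eta>_ropelength D
      by (simp add: Let_def)
  qed
qed

end
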